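(* Let $H$ and $G$ be graphs and let $k\geq 1$ be an integer. If $H$ is $k$-$G$-free-vertex-minimal, then \[|V(H)|\geq (k-1)(|V(G)|-1)+1.\]
   Context: All graphs are finite, simple and undirected. For a graph $G$ on at least 2 vertices, a $G$-free $k$-colouring of a graph $H$ is a map $\pi:V(H)\to\{1,\dots,k\}$ such that for every $i$ the subgraph of $H$ induced by $\pi^{-1}(i)$ contains no subgraph isomorphic to $G$. The $G$-free chromatic number $\chi_G(H)$ is the least $k$ for which a $G$-free $k$-colouring of $H$ exists. $H$ is $G$-free-vertex-minimal if $\chi_G(H\setminus\{v\})\leq\chi_G(H)-1$ for every vertex $v\in V(H)$; $H$ is $k$-$G$-free-vertex-minimal if moreover $\chi_G(H)=k$. *)

theory Defs
  imports "Graph_Theory.Graph_Theory" "HOL-Library.FuncSet"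
begin

text \<open>
  A finite simple undirected graph is represented by the locale \<^locale>\<open>graph\<close>: a finite
  loop-free digraph without parallel arcs whose arc set is symmetric, so that an undirected
  edge is a pair of opposite arcs. The null graph is allowed. A subgraph (in the digraph sense)
  isomorphic to a \<^locale>\<open>graph\<close> is automatically symmetric, i.e. a subgraph in the undirected
  sense.
\<close>

definition contains_copy :: "('a, 'b) pre_digraph \<Rightarrow> ('c, 'd) pre_digraph \<Rightarrow> bool" where
  "contains_copy H G \<longleftrightarrow> (\<exists>S. subgraph S H \<and> digraph_iso S G)"

definition free_colouring ::
    "('c, 'd) pre_digraph \<Rightarrow> nat \<Rightarrow> ('a, 'b) pre_digraph \<Rightarrow> ('a \<Rightarrow> nat) \<Rightarrow> bool" where
  "free_colouring G k H \<pi> \<longleftrightarrow>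
     \<pi> \<in> verts H \<rightarrow> {1..k} \<and>
     (\<forall>i\<in>{1..k}. \<not> contains_copy (H \<restriction> {v \<in> verts H. \<pi> v = i}) G)"

text \<open>The set of admissible \<open>k\<close> is nonempty whenever \<open>G\<close> has at least two vertices; see
  \<open>free_colouring_exists\<close> below.\<close>

definition free_chromatic_number :: "('c, 'd) pre_digraph \<Rightarrow> ('a, 'b) pre_digraph \<Rightarrow> nat" where
  "free_chromatic_number G H = (LEAST k. \<exists>\<pi>. free_colouring G k H \<pi>)"

text \<open>The inequality \<open>\<chi>\<^sub>G(H - v) \<le> \<chi>\<^sub>G(H) - 1\<close> is written additively to avoid truncated
  subtraction.\<close>

definition free_vertex_minimal :: "('c, 'd) pre_digraph \<Rightarrow> ('a, 'b) pre_digraph \<Rightarrow> bool" where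
  "free_vertex_minimal G H \<longleftrightarrow>
     (\<forall>v\<in>verts H.
        free_chromatic_number G (pre_digraph.del_vert H v) + 1 \<le> free_chromatic_number G H)"

definition k_free_vertex_minimal ::
    "nat \<Rightarrow> ('c, 'd) pre_digraph \<Rightarrow> ('a, 'b) pre_digraph \<Rightarrow> bool" where
  "k_free_vertex_minimal k G H \<longleftrightarrow>
     free_vertex_minimal G H \<and> free_chromatic_number G H = k"

lemma contains_copy_card_le:
  assumes "contains_copy H G" "finite (verts H)"
  shows "card (verts G) \<le> card (verts H)"
proof -
  obtain S f where S: "subgraph S H" "pre_digraph.digraph_isomorphism S f" "G = app_iso f S"
    using assms(1) unfolding contains_copy_def digraph_iso_def by blast
  then have "card (verts G) = card (verts S)"
    by (simp add: card_image pre_digraph.digraph_isomorphism_inj_on_verts)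
  also have "\<dots> \<le> card (verts H)"
    using S(1) assms(2) by (intro card_mono) (auto simp: subgraph_def)
  finally show ?thesis .
qed

lemma free_colouring_exists:
  assumes "graph H" "card (verts G) \<ge> 2"
  shows "\<exists>k \<pi>. free_colouring G k H \<pi>"
proof -
  have fin: "finite (verts H)"
    using assms(1) by (simp add: graph_def digraph_def fin_digraph.finite_verts)
  then obtain \<pi> where \<pi>: "bij_betw \<pi> (verts H) {1..card (verts H)}"
    using ex_bij_betw_finite_nat[of "verts H"] finite_same_card_bij[of "verts H" "{1..card (verts H)}"]
    by auto
  have "\<not> contains_copy (H \<restriction> {v \<in> verts H. \<pi> v = i}) G" for i
  proof
    assume c: "contains_copy (H \<restriction> {v \<in> verts H. \<pi> v = i}) G"
    have "card (verts G) \<le> card {v \<in> verts H. \<pi> v = i}"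
      using contains_copy_card_le[OF c] fin by simp
    moreover have "card {v \<in> verts H. \<pi> v = i} \<le> 1"
      using \<pi> fin by (auto simp: card_le_Suc0_iff_eq bij_betw_def dest: inj_onD)
    ultimately show False using assms(2) by simp
  qed
  then have "free_colouring G (card (verts H)) H \<pi>"
    using \<pi> unfolding free_colouring_def by (auto simp: bij_betw_def)
  then show ?thesis by blast
qed

end

theory Submission
  imports Defs
begin

text \<open>
  A colour class with fewer vertices than \<open>G\<close> cannot contain a copy of \<open>G\<close>. Cutting the vertices
  of \<open>H\<close> into at most \<open>k - 1\<close> blocks of size at most \<open>|V(G)| - 1\<close> would therefore give
  a \<open>G\<close>-free colouring with \<open>k - 1\<close> colours, contradicting \<open>\<chi>\<^sub>G(H) = k\<close>.
\<close>

lemma free_colouring_of_small_card: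
  fixes G :: "('c, 'd) pre_digraph" and H :: "('a, 'b) pre_digraph"
  assumes fin: "finite (verts H)" and le: "card (verts H) \<le> m * (card (verts G) - 1)"
    and G: "card (verts G) \<ge> 2"
  shows "\<exists>\<pi>. free_colouring G m H \<pi>"
proof -
  define d where "d = card (verts G) - 1"
  have d: "d > 0" "d < card (verts G)" using G by (auto simp: d_def)
  obtain f where f: "bij_betw f (verts H) {0..<card (verts H)}"
    using ex_bij_betw_finite_nat[OF fin] by blast
  \<comment> \<open>Number the vertices by \<open>f\<close> and cut the indices into consecutive
    blocks of length \<open>d\<close>; the shift by 1 makes colours start at 1.\<close>
  define \<pi> where "\<pi> v = f v div d + 1" for v
  have "\<pi> v \<in> {1..m}" if "v \<in> verts H" for v
  proof -
    have "f v < m * d"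
      using bij_betwE[OF f] that le by (fastforce simp: d_def)
    then show ?thesis
      using d by (simp add: \<pi>_def less_mult_imp_div_less Suc_leI)
  qed
  moreover have "\<not> contains_copy (H \<restriction> {v \<in> verts H. \<pi> v = i}) G" for i
  proof
    let ?C = "{v \<in> verts H. \<pi> v = i}"
    assume "contains_copy (H \<restriction> ?C) G"
    then have "card (verts G) \<le> card ?C"
      using contains_copy_card_le[of "H \<restriction> ?C" G] fin by simp
    \<comment> \<open>Colour \<open>i\<close> is the block of indices starting at
      \<open>(i - 1) * d\<close>. For \<open>i = 0\<close> the class is empty, so the truncated
      \<open>i - 1\<close> does no harm.\<close>
    also have "card ?C \<le> card {(i - 1) * d..<(i - 1) * d + d}"
    proof (rule card_inj_on_le)
      show "inj_on f ?C"
        using f by (auto simp: bij_betw_def intro: inj_on_subset)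
      show "f ` ?C \<subseteq> {(i - 1) * d..<(i - 1) * d + d}"
        using d(1) dividend_less_div_times[of d] by (auto simp: \<pi>_def add.commute)
    qed simp
    finally show False using d by simp
  qed
  ultimately have "free_colouring G m H \<pi>"
    unfolding free_colouring_def by blast
  then show ?thesis by blast
qed

theorem theorem11:
  fixes G :: "('c, 'd) pre_digraph" and H :: "('a, 'b) pre_digraph" and k :: nat
  assumes "graph H" and "graph G" and "card (verts G) \<ge> 2" and "k \<ge> 1"
    and "k_free_vertex_minimal k G H"
  shows "card (verts H) \<ge> (k - 1) * (card (verts G) - 1) + 1"
proof (rule ccontr)
  assume "\<not> ?thesis"
  then have "card (verts H) \<le> (k - 1) * (card (verts G) - 1)" by simp
  moreover have "finite (verts H)"
    using assms(1) by (simp add: graph_def digraph_def fin_digraph.finite_verts)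
  ultimately have "\<exists>\<pi>. free_colouring G (k - 1) H \<pi>"
    using assms(3) by (intro free_colouring_of_small_card)
  then have "free_chromatic_number G H \<le> k - 1"
    unfolding free_chromatic_number_def by (rule Least_le)
  \<comment> \<open>Since \<open>k \<ge> 1\<close>, the truncated \<open>k - 1\<close> is strictly
    below \<open>k\<close>, the value of the chromatic number.\<close>
  then show False
    using assms(4,5) by (simp add: k_free_vertex_minimal_def)
qed

end
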